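(* Let $X$ be a topological space and let $D\subset H_2(X)$ be a distributive subset. Then the subgroup of the group $H_2(X)$ generated by the set $D$ is a distributive subgroup, i.e. it is itself a distributive subset of $H_2(X)$.
   Context: For a topological space $X$, $C_2(X)$ denotes the set of all continuous binary operations $f:X^2\to X$. It is a monoid under the operation $(f\varphi)(x,y)=f(x,\varphi(x,y))$, with identity element $e(x,y)=y$. $H_2(X)$ denotes the group of all invertible elements of the monoid $C_2(X)$. An ordered pair $(g,h)$ of elements of $H_2(X)$ is called a distributive pair if $g(x,h(y,z))=h(g(x,y),g(x,z))$ for all $x,y,z\in X$. A subset $D\subset H_2(X)$ is called distributive if all its elements are pairwise distributive, i.e. $(g,h)$ is a distributive pair for all $g,h\in D$ (the case $g=h$ included). *)

theory Defs
  imports "HOL-Analysis.Abstract_Topology" "HOL-Analysis.Product_Topology" "HOL-Algebra.Generated_Groups"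
begin

text \<open>Binary operations on \<open>topspace X\<close> are functions on pairs that are extensional, i.e.
  \<open>undefined\<close> outside \<open>topspace X \<times> topspace X\<close>, so that HOL equality of the representing functions
  is equality of operations on the space.\<close>

definition C2 :: "'a topology \<Rightarrow> ('a \<times> 'a \<Rightarrow> 'a) monoid" where
  "C2 X =
    \<lparr>carrier = {f. continuous_map (prod_topology X X) X f \<and> f \<in> extensional (topspace X \<times> topspace X)},
     monoid.mult = (\<lambda>f \<phi>. \<lambda>(x, y) \<in> topspace X \<times> topspace X. f (x, \<phi> (x, y))),
     one = (\<lambda>(x, y) \<in> topspace X \<times> topspace X. y)\<rparr>"

definition H2 :: "'a topology \<Rightarrow> ('a \<times> 'a \<Rightarrow> 'a) monoid" where
  "H2 X = units_of (C2 X)"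

definition distributive_pair :: "'a topology \<Rightarrow> ('a \<times> 'a \<Rightarrow> 'a) \<Rightarrow> ('a \<times> 'a \<Rightarrow> 'a) \<Rightarrow> bool" where
  "distributive_pair X g h \<longleftrightarrow>
     g \<in> carrier (H2 X) \<and> h \<in> carrier (H2 X) \<and>
     (\<forall>x\<in>topspace X. \<forall>y\<in>topspace X. \<forall>z\<in>topspace X.
        g (x, h (y, z)) = h (g (x, y), g (x, z)))"

definition distributive_subset :: "'a topology \<Rightarrow> ('a \<times> 'a \<Rightarrow> 'a) set \<Rightarrow> bool" where
  "distributive_subset X D \<longleftrightarrow>
     D \<subseteq> carrier (H2 X) \<and> (\<forall>g\<in>D. \<forall>h\<in>D. distributive_pair X g h)"

definition distributive_subgroup :: "'a topology \<Rightarrow> ('a \<times> 'a \<Rightarrow> 'a) set \<Rightarrow> bool" where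
  "distributive_subgroup X G \<longleftrightarrow> subgroup G (H2 X) \<and> distributive_subset X G"

lemma carrier_C2_iff:
  "f \<in> carrier (C2 X) \<longleftrightarrow>
     continuous_map (prod_topology X X) X f \<and> f \<in> extensional (topspace X \<times> topspace X)"
  by (simp add: C2_def)

lemma C2_closed:
  assumes "f \<in> carrier (C2 X)" "x \<in> topspace X" "y \<in> topspace X"
  shows "f (x, y) \<in> topspace X"
  using assms by (auto simp: carrier_C2_iff continuous_map_def Pi_iff)

lemma C2_mult_apply:
  assumes "x \<in> topspace X" "y \<in> topspace X"
  shows "(f \<otimes>\<^bsub>C2 X\<^esub> g) (x, y) = f (x, g (x, y))"
  using assms by (simp add: C2_def)

lemma C2_one_apply:
  assumes "x \<in> topspace X" "y \<in> topspace X"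
  shows "\<one>\<^bsub>C2 X\<^esub> (x, y) = y"
  using assms by (simp add: C2_def)

lemma C2_mult_closed:
  assumes "f \<in> carrier (C2 X)" "g \<in> carrier (C2 X)"
  shows "f \<otimes>\<^bsub>C2 X\<^esub> g \<in> carrier (C2 X)"
proof -
  have "continuous_map (prod_topology X X) (prod_topology X X) (\<lambda>p. (fst p, g p))"
    using assms by (auto simp: carrier_C2_iff continuous_map_paired continuous_map_fst)
  then have "continuous_map (prod_topology X X) X (f \<circ> (\<lambda>p. (fst p, g p)))"
    using assms continuous_map_compose carrier_C2_iff by blast
  then have "continuous_map (prod_topology X X) X (f \<otimes>\<^bsub>C2 X\<^esub> g)"
    by (rule continuous_map_eq) (auto simp: C2_mult_apply)
  then show ?thesis
    by (simp add: carrier_C2_iff) (simp add: C2_def)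
qed

lemma C2_one_closed: "\<one>\<^bsub>C2 X\<^esub> \<in> carrier (C2 X)"
proof -
  have "continuous_map (prod_topology X X) X snd"
    by (rule continuous_map_snd)
  then have "continuous_map (prod_topology X X) X \<one>\<^bsub>C2 X\<^esub>"
    by (rule continuous_map_eq) (auto simp: C2_one_apply)
  then show ?thesis
    by (simp add: carrier_C2_iff) (simp add: C2_def)
qed

lemma C2_eqI:
  assumes "f \<in> carrier (C2 X)" "g \<in> carrier (C2 X)"
    and "\<And>x y. x \<in> topspace X \<Longrightarrow> y \<in> topspace X \<Longrightarrow> f (x, y) = g (x, y)"
  shows "f = g"
  using assms by (intro extensionalityI[of f "topspace X \<times> topspace X" g]) (auto simp: carrier_C2_iff)

lemma monoid_C2: "monoid (C2 X)"
proof (rule monoidI)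
  fix f g h
  assume fgh: "f \<in> carrier (C2 X)" "g \<in> carrier (C2 X)" "h \<in> carrier (C2 X)"
  then show "f \<otimes>\<^bsub>C2 X\<^esub> g \<otimes>\<^bsub>C2 X\<^esub> h = f \<otimes>\<^bsub>C2 X\<^esub> (g \<otimes>\<^bsub>C2 X\<^esub> h)"
    by (intro C2_eqI[where X = X]) (simp_all add: C2_mult_closed C2_mult_apply C2_closed)
next
  fix f assume "f \<in> carrier (C2 X)"
  then show "\<one>\<^bsub>C2 X\<^esub> \<otimes>\<^bsub>C2 X\<^esub> f = f" "f \<otimes>\<^bsub>C2 X\<^esub> \<one>\<^bsub>C2 X\<^esub> = f"
    by (auto intro!: C2_eqI[where X = X] simp: C2_mult_closed C2_one_closed C2_mult_apply C2_one_apply C2_closed)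
qed (simp_all add: C2_mult_closed C2_one_closed)

lemma group_H2: "group (H2 X)"
  unfolding H2_def by (rule monoid.units_group[OF monoid_C2])

end

theory Submission
  imports Defs
begin

text \<open>An invertible operation \<open>g\<close> yields a family of bijections \<open>y \<mapsto> g (x, y)\<close> of the space, one
  for each \<open>x\<close>, and the product of operations is composition of these bijections for each fixed \<open>x\<close>.
  The pair \<open>(g, h)\<close> is distributive precisely when each bijection \<open>g (x, \<cdot>)\<close> is an automorphism of the
  algebra whose single operation is \<open>h\<close>.

  Two closure properties follow. For fixed \<open>h\<close>, automorphisms of \<open>h\<close> compose and invert, so the
  admissible \<open>g\<close> form a subgroup. For fixed \<open>g\<close>, a map that commutes with \<open>h\<close> and \<open>k\<close> also commutes with
  every operation derived from them, in particular with \<open>h (y, k (y, z))\<close>, and with the operation that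
  solves \<open>h (y, w) = z\<close> for \<open>w\<close>; so the admissible \<open>h\<close> form a subgroup as well.

  Each of these subgroups contains the subgroup generated by any of its subsets. Hence one may pass
  from \<open>D\<close> to the subgroup generated by \<open>D\<close> in the first argument, with the second still in \<open>D\<close>, and
  then in the second argument, with the first anywhere in the generated subgroup.\<close>

lemma H2_closed:
  assumes "g \<in> carrier (H2 X)" "x \<in> topspace X" "y \<in> topspace X"
  shows "g (x, y) \<in> topspace X"
  using assms by (auto simp: H2_def units_of_carrier Units_def intro: C2_closed)

lemma H2_mult_apply:
  assumes "x \<in> topspace X" "y \<in> topspace X"
  shows "(g \<otimes>\<^bsub>H2 X\<^esub> h) (x, y) = g (x, h (x, y))"
  using assms by (simp add: H2_def units_of_mult C2_mult_apply)

lemma H2_one_apply: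
  assumes "x \<in> topspace X" "y \<in> topspace X"
  shows "\<one>\<^bsub>H2 X\<^esub> (x, y) = y"
  using assms by (simp add: H2_def units_of_one C2_one_apply)

lemma H2_apply_inv:
  assumes "g \<in> carrier (H2 X)" "x \<in> topspace X" "y \<in> topspace X"
  shows "g (x, (inv\<^bsub>H2 X\<^esub> g) (x, y)) = y"
  using assms group.r_inv[OF group_H2 assms(1)]
  by (metis H2_mult_apply H2_one_apply)

lemma H2_inv_apply:
  assumes "g \<in> carrier (H2 X)" "x \<in> topspace X" "y \<in> topspace X"
  shows "(inv\<^bsub>H2 X\<^esub> g) (x, g (x, y)) = y"
  using assms group.l_inv[OF group_H2 assms(1)]
  by (metis H2_mult_apply H2_one_apply)

lemma distributive_pairD:
  assumes "distributive_pair X g h" "x \<in> topspace X" "y \<in> topspace X" "z \<in> topspace X"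
  shows "g (x, h (y, z)) = h (g (x, y), g (x, z))"
  using assms by (simp add: distributive_pair_def)

lemma distributive_pair_carrier:
  assumes "distributive_pair X g h"
  shows "g \<in> carrier (H2 X)" "h \<in> carrier (H2 X)"
  using assms by (simp_all add: distributive_pair_def)

text \<open>The left translations \<open>g (x, \<cdot>)\<close> are automorphisms of \<open>h\<close>, and automorphisms are closed under
  composition and inversion.\<close>

lemma subgroup_left_distributive:
  assumes h: "h \<in> carrier (H2 X)"
  shows "subgroup {g. distributive_pair X g h} (H2 X)"
proof (rule group.subgroupI[OF group_H2])
  interpret group "H2 X" by (rule group_H2)
  show "{g. distributive_pair X g h} \<subseteq> carrier (H2 X)"
    by (auto simp: distributive_pair_carrier)
  have "distributive_pair X \<one>\<^bsub>H2 X\<^esub> h"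
    using h by (simp add: distributive_pair_def H2_one_apply H2_closed)
  then show "{g. distributive_pair X g h} \<noteq> {}"
    by blast
next
  interpret group "H2 X" by (rule group_H2)
  fix g assume "g \<in> {g. distributive_pair X g h}"
  then have g: "distributive_pair X g h" by simp
  note gc = distributive_pair_carrier(1)[OF g]
  let ?i = "inv\<^bsub>H2 X\<^esub> g"
  have "?i (x, h (y, z)) = h (?i (x, y), ?i (x, z))"
    if xyz: "x \<in> topspace X" "y \<in> topspace X" "z \<in> topspace X" for x y z
  proof -
    have iy: "?i (x, y) \<in> topspace X" and iz: "?i (x, z) \<in> topspace X"
      using gc xyz by (simp_all add: H2_closed)
    have "g (x, h (?i (x, y), ?i (x, z))) = h (y, z)"
      using distributive_pairD[OF g xyz(1) iy iz] gc xyz by (simp add: H2_apply_inv)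
    then show ?thesis
      using H2_inv_apply[OF gc xyz(1) H2_closed[OF h iy iz]] by simp
  qed
  then show "?i \<in> {g. distributive_pair X g h}"
    using gc h by (simp add: distributive_pair_def)
next
  interpret group "H2 X" by (rule group_H2)
  fix g k assume "g \<in> {g. distributive_pair X g h}" "k \<in> {g. distributive_pair X g h}"
  then have g: "distributive_pair X g h" and k: "distributive_pair X k h" by simp_all
  note gc = distributive_pair_carrier(1)[OF g] and kc = distributive_pair_carrier(1)[OF k]
  show "g \<otimes>\<^bsub>H2 X\<^esub> k \<in> {g. distributive_pair X g h}"
    using gc kc h
    by (simp add: distributive_pair_def H2_mult_apply H2_closed
        distributive_pairD[OF g] distributive_pairD[OF k])
qed

text \<open>A map that commutes with given operations commutes with the operations obtained from them by
  substitution, and by solving \<open>h (y, w) = z\<close> for \<open>w\<close>.\<close>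

lemma subgroup_right_distributive:
  assumes g: "g \<in> carrier (H2 X)"
  shows "subgroup {h. distributive_pair X g h} (H2 X)"
proof (rule group.subgroupI[OF group_H2])
  interpret group "H2 X" by (rule group_H2)
  show "{h. distributive_pair X g h} \<subseteq> carrier (H2 X)"
    by (auto simp: distributive_pair_carrier)
  have "distributive_pair X g \<one>\<^bsub>H2 X\<^esub>"
    using g by (simp add: distributive_pair_def H2_one_apply H2_closed)
  then show "{h. distributive_pair X g h} \<noteq> {}"
    by blast
next
  interpret group "H2 X" by (rule group_H2)
  fix h assume "h \<in> {h. distributive_pair X g h}"
  then have h: "distributive_pair X g h" by simp
  note hc = distributive_pair_carrier(2)[OF h]
  let ?i = "inv\<^bsub>H2 X\<^esub> h"
  have "g (x, ?i (y, z)) = ?i (g (x, y), g (x, z))"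
    if xyz: "x \<in> topspace X" "y \<in> topspace X" "z \<in> topspace X" for x y z
  proof -
    have w: "?i (y, z) \<in> topspace X"
      using hc xyz by (simp add: H2_closed)
    \<comment> \<open>Both sides solve \<open>h (g (x, y), w) = g (x, z)\<close> for \<open>w\<close>, and \<open>h (g (x, y), \<cdot>)\<close> is injective.\<close>
    have "h (g (x, y), g (x, ?i (y, z))) = g (x, z)"
      using distributive_pairD[OF h xyz(1,2) w] hc xyz by (simp add: H2_apply_inv)
    then show ?thesis
      using H2_inv_apply[OF hc H2_closed[OF g xyz(1,2)] H2_closed[OF g xyz(1) w]] by simp
  qed
  then show "?i \<in> {h. distributive_pair X g h}"
    using g hc by (simp add: distributive_pair_def)
next
  interpret group "H2 X" by (rule group_H2)
  fix h k assume "h \<in> {h. distributive_pair X g h}" "k \<in> {h. distributive_pair X g h}"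
  then have h: "distributive_pair X g h" and k: "distributive_pair X g k" by simp_all
  note hc = distributive_pair_carrier(2)[OF h] and kc = distributive_pair_carrier(2)[OF k]
  show "h \<otimes>\<^bsub>H2 X\<^esub> k \<in> {h. distributive_pair X g h}"
    using hc kc g
    by (simp add: distributive_pair_def H2_mult_apply H2_closed
        distributive_pairD[OF h] distributive_pairD[OF k])
qed

theorem theorem3p4:
  fixes X :: "'a topology" and D :: "('a \<times> 'a \<Rightarrow> 'a) set"
  assumes "distributive_subset X D"
  shows "distributive_subgroup X (generate (H2 X) D)"
proof -
  interpret group "H2 X" by (rule group_H2)
  let ?G = "generate (H2 X) D"
  have D: "D \<subseteq> carrier (H2 X)" and DD: "\<And>g h. g \<in> D \<Longrightarrow> h \<in> D \<Longrightarrow> distributive_pair X g h"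
    using assms by (auto simp: distributive_subset_def)
  have G: "subgroup ?G (H2 X)"
    by (rule generate_is_subgroup[OF D])
  have GD: "distributive_pair X g h" if "g \<in> ?G" "h \<in> D" for g h
    using generate_subgroup_incl[of D "{g. distributive_pair X g h}"]
      subgroup_left_distributive[of h X] DD D that by blast
  have "distributive_pair X g h" if "g \<in> ?G" "h \<in> ?G" for g h
    using generate_subgroup_incl[of D "{h. distributive_pair X g h}"]
      subgroup_right_distributive[of g X] GD subgroup.subset[OF G] that by blast
  then show ?thesis
    using G subgroup.subset[OF G]
    by (simp add: distributive_subgroup_def distributive_subset_def)
qed

end
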